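(* Let $X\subset\mathbb R^2$ be a dendroid in the plane which is smooth at $p$. Within the space $E(X)\setminus\{p\}$, every two points are separated by two other points.
   Context: A continuum is a compact connected metric space. It is hereditarily unicoherent if every two of its subcontinua have connected intersection. A dendroid is a hereditarily unicoherent, arcwise connected continuum (hence uniquely arcwise connected); for $x,y$ in a dendroid $X$, $\alpha(x,y)$ denotes the unique arc in $X$ with endpoints $x$ and $y$. A dendroid $X$ is smooth at $p\in X$ if whenever $x_n\to x$ in $X$, $\alpha(x_n,p)\to\alpha(x,p)$ in the Hausdorff distance. A point $e\in X$ is an endpoint if $e$ is an endpoint of every arc in $X$ that contains it; $E(X)$ is the set of all endpoints of $X$, and $E(X)\setminus\{p\}$ carries the subspace topology. In a space $Y$, two points $a,b$ are separated by two other points $c,d\in Y\setminus\{a,b\}$ if $Y\setminus\{c,d\}$ is the union of two disjoint relatively open subsets, one containing $a$ and the other containing $b$.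
   Formalization: It is assumed that E(X)∖{p} contains two distinct points other than the two given ones; otherwise (for example X an arc and p an interior point) no two other points exist and the claim fails. *)

theory Defs
  imports "HOL-Analysis.Analysis"
begin

definition continuum :: "'a::metric_space set \<Rightarrow> bool"
  where "continuum X \<longleftrightarrow> X \<noteq> {} \<and> compact X \<and> connected X"

definition hereditarily_unicoherent :: "'a::metric_space set \<Rightarrow> bool"
  where "hereditarily_unicoherent X \<longleftrightarrow>
    (\<forall>K L. K \<subseteq> X \<and> continuum K \<and> L \<subseteq> X \<and> continuum L \<longrightarrow> connected (K \<inter> L))"

definition arc_between :: "'a::metric_space set \<Rightarrow> 'a \<Rightarrow> 'a \<Rightarrow> bool"
  where "arc_between A x y \<longleftrightarrow>
    (\<exists>g. arc g \<and> path_image g = A \<and> pathstart g = x \<and> pathfinish g = y)"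

definition arcwise_connected :: "'a::metric_space set \<Rightarrow> bool"
  where "arcwise_connected X \<longleftrightarrow>
    (\<forall>x\<in>X. \<forall>y\<in>X. x \<noteq> y \<longrightarrow> (\<exists>A. A \<subseteq> X \<and> arc_between A x y))"

definition dendroid :: "'a::metric_space set \<Rightarrow> bool"
  where "dendroid X \<longleftrightarrow> continuum X \<and> hereditarily_unicoherent X \<and> arcwise_connected X"

(* alpha(x,x) is the degenerate arc {x}; for x \<noteq> y in a dendroid the description is
   well defined, see dendroid_unique_arc below *)
definition the_arc :: "'a::metric_space set \<Rightarrow> 'a \<Rightarrow> 'a \<Rightarrow> 'a set"
  where "the_arc X x y = (if x = y then {x} else (THE A. A \<subseteq> X \<and> arc_between A x y))"

(* the Hausdorff distance on nonempty bounded sets *)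
definition hausdorff_dist :: "'a::metric_space set \<Rightarrow> 'a set \<Rightarrow> real"
  where "hausdorff_dist A B = max (SUP x\<in>A. infdist x B) (SUP y\<in>B. infdist y A)"

definition smooth_at :: "'a::metric_space set \<Rightarrow> 'a \<Rightarrow> bool"
  where "smooth_at X p \<longleftrightarrow> p \<in> X \<and>
    (\<forall>s x. (\<forall>n. s n \<in> X) \<and> x \<in> X \<and> s \<longlonglongrightarrow> x \<longrightarrow>
       (\<lambda>n. hausdorff_dist (the_arc X (s n) p) (the_arc X x p)) \<longlonglongrightarrow> 0)"

definition endpoints :: "'a::metric_space set \<Rightarrow> 'a set"
  where "endpoints X =
    {e \<in> X. \<forall>A x y. A \<subseteq> X \<and> arc_between A x y \<and> e \<in> A \<longrightarrow> e = x \<or> e = y}"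

definition separated_by_points :: "'a::topological_space set \<Rightarrow> 'a \<Rightarrow> 'a \<Rightarrow> 'a \<Rightarrow> 'a \<Rightarrow> bool"
  where "separated_by_points Y a b c d \<longleftrightarrow>
    (\<exists>U V. openin (top_of_set (Y - {c, d})) U \<and> openin (top_of_set (Y - {c, d})) V \<and>
       U \<inter> V = {} \<and> U \<union> V = Y - {c, d} \<and> a \<in> U \<and> b \<in> V)"

lemma arc_between_connected_subset:
  assumes "arc_between A x y" "C \<subseteq> A" "connected C" "x \<in> C" "y \<in> C"
  shows "C = A"
proof -
  obtain g where g: "arc g" "path_image g = A" "g 0 = x" "g 1 = y"
    using assms(1) by (auto simp: arc_between_def pathstart_def pathfinish_def)
  obtain h where "homeomorphism {0..1} A g h"
    using homeomorphism_arc[OF g(1)] g(2) by metis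
  then have h: "\<And>t. t \<in> {0..1} \<Longrightarrow> h (g t) = t" "\<And>z. z \<in> A \<Longrightarrow> g (h z) = z"
    "continuous_on A h" "g ` {0..1} = A"
    by (simp_all add: homeomorphism_def)
  have "connected (h ` C)"
    by (rule connected_continuous_image[OF continuous_on_subset[OF h(3) assms(2)] assms(3)])
  moreover have "0 \<in> h ` C"
    using h(1)[of 0] g(3) assms(4) by (intro image_eqI[of _ _ x]) simp_all
  moreover have "1 \<in> h ` C"
    using h(1)[of 1] g(4) assms(5) by (intro image_eqI[of _ _ y]) simp_all
  ultimately have sub: "{0..1} \<subseteq> h ` C"
    by (rule connected_contains_Icc)
  have "A \<subseteq> C"
  proof
    fix z assume "z \<in> A"
    then obtain t where t: "t \<in> {0..1}" "z = g t"
      using h(4) by blast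
    then obtain w where "w \<in> C" "t = h w"
      using sub by blast
    then show "z \<in> C"
      using t(2) h(2)[of w] assms(2) by auto
  qed
  with assms(2) show ?thesis by blast
qed

lemma dendroid_unique_arc:
  assumes "dendroid X" "x \<in> X" "y \<in> X" "x \<noteq> y"
  shows "\<exists>!A. A \<subseteq> X \<and> arc_between A x y"
proof -
  have cont: "continuum A \<and> x \<in> A \<and> y \<in> A" if A: "arc_between A x y" for A
  proof -
    obtain g where g: "arc g" "path_image g = A" "pathstart g = x" "pathfinish g = y"
      using A unfolding arc_between_def by blast
    then have "path g" "x \<in> A" "y \<in> A"
      by (auto simp: arc_imp_path)
    then show ?thesis
      using compact_path_image[of g] connected_path_image[of g] g(2)
      unfolding continuum_def by blast
  qed
  have "A = B" if "A \<subseteq> X" "arc_between A x y" "B \<subseteq> X" "arc_between B x y" for A B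
  proof -
    have "connected (A \<inter> B)"
      using assms(1) that cont unfolding dendroid_def hereditarily_unicoherent_def by blast
    then show ?thesis
      using arc_between_connected_subset[of A x y "A \<inter> B"]
        arc_between_connected_subset[of B x y "A \<inter> B"] that cont by auto
  qed
  then show ?thesis
    using assms unfolding dendroid_def arcwise_connected_def by blast
qed

end

theory Submission
  imports Defs
begin

text \<open>
  Identify the plane with the complex numbers.  For distinct \<open>x, y\<close> in \<open>E(X) - {p}\<close>, the
  endpoint \<open>x\<close> is not on \<open>\<alpha>(y,p)\<close>, so the change \<open>\<Lambda>(x,y)\<close> of a continuous branch of
  \<open>log (z - x)\<close> along that arc is defined; smoothness at \<open>p\<close> makes it continuous in \<open>y\<close>, and it is
  continuous in \<open>x\<close> anyway.  Put \<open>\<omega>(x,y) = \<Lambda>(x,y) - \<Lambda>(y,x)\<close>.  Then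
  \<open>C(a,b,c) = \<omega>(a,b) + \<omega>(b,c) + \<omega>(c,a)\<close> is a continuous alternating cocycle with
  \<open>exp C = -1\<close>, hence nonvanishing and locally constant in each variable: it plays the role of the
  cyclic order of the endpoints.  If \<open>C(c,d,a) \<noteq> C(c,d,b)\<close> for some \<open>c, d\<close>, the level sets of
  \<open>C(c,d,\<cdot>)\<close> separate \<open>a\<close> from \<open>b\<close>.  Otherwise \<open>a, b\<close> are adjacent, and for any \<open>c\<close> the level
  sets of \<open>C(b,c,\<cdot>)\<close> do, with \<open>b\<close> added to the one not containing \<open>a\<close>.
\<close>

section \<open>Variation of the logarithm\<close>

text \<open>Any one continuous branch of the logarithm computes this number, by
  \<open>log_change_eq\<close>; for smooth data it is the integral of \<open>df/f\<close> along
  \<open>A\<close> from \<open>x\<close> to \<open>y\<close>. No parametrization enters, so arcs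
  that are close only as sets can be compared.\<close>

definition log_change :: "'a::topological_space set \<Rightarrow> ('a \<Rightarrow> complex) \<Rightarrow> 'a \<Rightarrow> 'a \<Rightarrow> complex"
  where "log_change A f x y =
    (THE d. \<exists>g. continuous_on A g \<and> (\<forall>z\<in>A. exp (g z) = f z) \<and> d = g y - g x)"

lemma exp_eq_dist_less_imp_eq:
  fixes u v :: complex
  assumes "exp u = exp v" "dist u v < 1"
  shows "u = v"
proof (rule exp_complex_eqI)
  have "\<bar>Im u - Im v\<bar> \<le> dist u v"
    using abs_Im_le_cmod[of "u - v"] by (simp add: dist_norm)
  then show "\<bar>Im u - Im v\<bar> < 2 * pi"
    using assms(2) pi_gt3 by linarith
qed (fact assms(1))

text \<open>The difference of two branches takes values in the discrete set of periods of
  \<open>exp\<close>, hence is constant on the connected set \<open>A\<close>.\<close>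

lemma continuous_logarithm_diff_unique:
  fixes g h :: "'a::topological_space \<Rightarrow> complex"
  assumes "connected A" "x \<in> A" "y \<in> A" "continuous_on A g" "continuous_on A h"
    and "\<And>z. z \<in> A \<Longrightarrow> exp (g z) = exp (h z)"
  shows "g y - g x = h y - h x"
proof -
  have "(\<lambda>z. g z - h z) constant_on A"
  proof (rule continuous_discrete_range_constant[OF assms(1)])
    show "continuous_on A (\<lambda>z. g z - h z)"
      using assms(4,5) by (intro continuous_intros)
    fix z assume "z \<in> A"
    have "1 \<le> norm ((g w - h w) - (g z - h z))" if "w \<in> A" "g w - h w \<noteq> g z - h z" for w
      using exp_eq_dist_less_imp_eq[of "g w - h w" "g z - h z"] that \<open>z \<in> A\<close> assms(6)
      by (force simp: exp_diff dist_norm)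
    then show "\<exists>e>0. \<forall>w. w \<in> A \<and> g w - h w \<noteq> g z - h z \<longrightarrow> e \<le> norm ((g w - h w) - (g z - h z))"
      by (intro exI[of _ 1]) auto
  qed
  then obtain k where "\<And>z. z \<in> A \<Longrightarrow> g z - h z = k"
    by (auto simp: constant_on_def)
  from this[OF assms(2)] this[OF assms(3)] show ?thesis
    by (simp add: algebra_simps)
qed

lemma log_change_eq:
  assumes "connected A" "x \<in> A" "y \<in> A" "continuous_on A g"
    and "\<And>z. z \<in> A \<Longrightarrow> exp (g z) = f z"
  shows "log_change A f x y = g y - g x"
  unfolding log_change_def
proof (rule the_equality)
  show "\<exists>g'. continuous_on A g' \<and> (\<forall>z\<in>A. exp (g' z) = f z) \<and> g y - g x = g' y - g' x"
    using assms(4,5) by blast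
  fix d
  assume "\<exists>g'. continuous_on A g' \<and> (\<forall>z\<in>A. exp (g' z) = f z) \<and> d = g' y - g' x"
  then show "d = g y - g x"
    using continuous_logarithm_diff_unique[OF assms(1-3) _ assms(4)] assms(5) by force
qed

lemma arc_between_imp:
  assumes "arc_between A x y"
  shows "compact A" "connected A" "x \<in> A" "y \<in> A"
  using assms
  by (auto simp: arc_between_def arc_imp_path compact_path_image connected_path_image)

lemma arc_between_contractible:
  fixes A :: "'a::real_normed_vector set"
  assumes "arc_between A x y"
  shows "contractible A"
proof -
  obtain g where "arc g" "path_image g = A"
    using assms by (auto simp: arc_between_def)
  then obtain h where "homeomorphism {0..1} A g h"
    using homeomorphism_arc by metis
  then show ?thesis
    using homeomorphic_contractible[of "{0..1::real}" A] convex_imp_contractible[of "{0..1::real}"]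
    by (auto simp: homeomorphic_def)
qed

lemma arc_between_logarithm:
  fixes A :: "'a::real_normed_vector set" and f :: "'a \<Rightarrow> complex"
  assumes "arc_between A x y" "continuous_on A f" "\<And>z. z \<in> A \<Longrightarrow> f z \<noteq> 0"
  obtains g where "continuous_on A g" "\<And>z. z \<in> A \<Longrightarrow> exp (g z) = f z"
  using continuous_logarithm_on_contractible[OF assms(2) arc_between_contractible[OF assms(1)] assms(3)]
  by metis

lemma exp_log_change:
  fixes A :: "'a::real_normed_vector set"
  assumes A: "arc_between A x y" and f: "continuous_on A f" "\<And>z. z \<in> A \<Longrightarrow> f z \<noteq> 0"
  shows "exp (log_change A f x y) = f y / f x"
proof -
  obtain g where g: "continuous_on A g" "\<And>z. z \<in> A \<Longrightarrow> exp (g z) = f z"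
    using arc_between_logarithm[OF A f] by blast
  show ?thesis
    using log_change_eq[OF _ _ _ g, of x y] arc_between_imp[OF A] g(2) by (simp add: exp_diff)
qed

text \<open>The quotient \<open>h/f\<close> stays in the unit disc about 1, where \<open>Ln\<close>
  is continuous; adding \<open>Ln (h z / f z)\<close> to a branch for \<open>f\<close> therefore
  gives a branch for \<open>h\<close>.\<close>

lemma log_change_perturb:
  fixes A :: "'a::real_normed_vector set"
  assumes A: "arc_between A x y"
    and f: "continuous_on A f" "\<And>z. z \<in> A \<Longrightarrow> f z \<noteq> 0"
    and h: "continuous_on A h" "\<And>z. z \<in> A \<Longrightarrow> norm (h z - f z) < norm (f z)"
  shows "log_change A h x y = log_change A f x y + (Ln (h y / f y) - Ln (h x / f x))"
proof -
  obtain g where g: "continuous_on A g" "\<And>z. z \<in> A \<Longrightarrow> exp (g z) = f z"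
    using arc_between_logarithm[OF A f] by blast
  have near: "h z / f z \<notin> \<real>\<^sub>\<le>\<^sub>0" if "z \<in> A" for z
  proof -
    have "h z / f z - 1 = (h z - f z) / f z"
      using f(2)[OF that] by (simp add: diff_divide_distrib)
    then have "norm (h z / f z - 1) < 1"
      using h(2)[OF that] f(2)[OF that] by (simp add: norm_divide)
    then have "Re (h z / f z) > 0"
      using abs_Re_le_cmod[of "h z / f z - 1"] by simp
    then show ?thesis
      by (auto simp: complex_nonpos_Reals_iff)
  qed
  have "continuous_on A (\<lambda>z. g z + Ln (h z / f z))"
    using f h near by (intro continuous_intros g(1)) auto
  moreover have "exp (g z + Ln (h z / f z)) = h z" if "z \<in> A" for z
  proof -
    have "h z \<noteq> 0"
      using near[OF that] by auto
    then show ?thesis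
      using f(2)[OF that] g(2)[OF that] by (simp add: exp_add)
  qed
  ultimately have "log_change A h x y = (g y + Ln (h y / f y)) - (g x + Ln (h x / f x))"
    using arc_between_imp[OF A] by (intro log_change_eq) auto
  moreover have "log_change A f x y = g y - g x"
    using arc_between_imp[OF A] by (intro log_change_eq g) auto
  ultimately show ?thesis
    by simp
qed

text \<open>Extend a branch on \<open>K\<close> by Tietze and divide out the error with the principal logarithm.\<close>

lemma continuous_logarithm_extend_open:
  fixes f :: "'a::euclidean_space \<Rightarrow> complex"
  assumes "closed K" and f: "continuous_on UNIV f" "\<And>z. z \<in> K \<Longrightarrow> f z \<noteq> 0"
    and g: "continuous_on K g" "\<And>z. z \<in> K \<Longrightarrow> exp (g z) = f z"
  obtains W G where "open W" "K \<subseteq> W" "continuous_on W G" "\<And>z. z \<in> W \<Longrightarrow> exp (G z) = f z"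
proof -
  obtain H where H: "continuous_on UNIV H" "\<And>z. z \<in> K \<Longrightarrow> H z = g z"
    using Tietze_unbounded[OF g(1), of UNIV] assms(1) by auto
  define q where "q z = f z * exp (- H z)" for z
  have contq: "continuous_on S q" for S
    unfolding q_def
    by (intro continuous_intros continuous_on_subset[OF f(1)] continuous_on_subset[OF H(1)]) auto
  define W where "W = q -` (- \<real>\<^sub>\<le>\<^sub>0)"
  have "open W"
    unfolding W_def using contq by (intro open_vimage) (auto simp: closed_nonpos_Reals_complex)
  moreover have "K \<subseteq> W"
    using g(2) H(2) by (auto simp: W_def q_def exp_minus simp flip: g(2))
  moreover have "continuous_on W (\<lambda>z. H z + Ln (q z))"
    by (intro continuous_intros continuous_on_subset[OF H(1)] contq) (auto simp: W_def)
  moreover have "exp (H z + Ln (q z)) = f z" if "z \<in> W" for z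
  proof -
    have "q z \<noteq> 0"
      using that by (auto simp: W_def)
    then show ?thesis
      by (simp add: exp_add q_def exp_minus)
  qed
  ultimately show ?thesis
    using that by blast
qed

section \<open>Arcs of a smooth dendroid\<close>

text \<open>Boundedness of \<open>A\<close> makes the supremum over \<open>A\<close> inside
  \<open>hausdorff_dist\<close> a genuine least upper bound.\<close>

lemma infdist_le_hausdorff_dist:
  assumes "bounded A" "B \<noteq> {}" "y \<in> A"
  shows "infdist y B \<le> hausdorff_dist A B"
proof -
  have "bdd_above ((\<lambda>x. infdist x B) ` A)"
  proof -
    obtain b where "b \<in> B"
      using assms(2) by blast
    obtain r where "\<And>x. x \<in> A \<Longrightarrow> dist b x \<le> r"
      using assms(1) by (meson bounded_any_center)
    then have "infdist x B \<le> r" if "x \<in> A" for x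
      using infdist_le[OF \<open>b \<in> B\<close>, of x] that by (metis dist_commute order_trans)
    then show ?thesis
      by (rule bdd_aboveI2)
  qed
  then have "infdist y B \<le> (SUP x\<in>A. infdist x B)"
    by (rule cSUP_upper[OF assms(3)])
  then show ?thesis
    by (simp add: hausdorff_dist_def)
qed

lemma the_arc_properties:
  assumes "dendroid X" "x \<in> X" "y \<in> X" "x \<noteq> y"
  shows "the_arc X x y \<subseteq> X" "arc_between (the_arc X x y) x y"
  using theI'[OF dendroid_unique_arc[OF assms]] assms(4) by (auto simp: the_arc_def)

lemma endpoint_notin_the_arc:
  assumes "dendroid X" "p \<in> X" "x \<in> X" "x \<noteq> p" "e \<in> endpoints X" "e \<noteq> x" "e \<noteq> p"
  shows "e \<notin> the_arc X x p"
  using the_arc_properties[OF assms(1,3,2,4)] assms(5-7) unfolding endpoints_def by blast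

text \<open>A branch on the limit arc extends to an open set around it, and smoothness eventually
  traps the nearby arcs there. A single branch \<open>G\<close> then computes all these changes, and
  its continuity at \<open>x\<close> suffices.\<close>

lemma log_change_the_arc_tendsto:
  fixes X :: "'a::euclidean_space set" and f :: "'a \<Rightarrow> complex"
  assumes X: "dendroid X" "smooth_at X p"
    and x: "x \<in> X - {p}" and s: "\<And>n. s n \<in> X - {p}" "s \<longlonglongrightarrow> x"
    and f: "continuous_on UNIV f" "\<And>z. z \<in> the_arc X x p \<Longrightarrow> f z \<noteq> 0"
  shows "(\<lambda>n. log_change (the_arc X (s n) p) f (s n) p) \<longlonglongrightarrow> log_change (the_arc X x p) f x p"
proof -
  have p: "p \<in> X"
    using X(2) by (simp add: smooth_at_def)
  define A where "A = the_arc X x p"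
  define B where "B n = the_arc X (s n) p" for n
  have A: "arc_between A x p"
    using the_arc_properties[OF X(1) _ p] x by (auto simp: A_def)
  have B: "arc_between (B n) (s n) p" for n
    using the_arc_properties[OF X(1) _ p] s(1) by (auto simp: B_def)
  note Ap = arc_between_imp[OF A] and Bp = arc_between_imp[OF B]
  obtain g where g: "continuous_on A g" "\<And>z. z \<in> A \<Longrightarrow> exp (g z) = f z"
    using arc_between_logarithm[OF A, of f] f continuous_on_subset[OF f(1)] by (auto simp: A_def)
  obtain W G where W: "open W" "A \<subseteq> W" and G: "continuous_on W G" "\<And>z. z \<in> W \<Longrightarrow> exp (G z) = f z"
    using continuous_logarithm_extend_open[OF compact_imp_closed[OF Ap(1)] f(1) _ g] f(2)
    by (auto simp: A_def)
  obtain e where e: "e > 0" "{z. infdist z A \<le> e} \<subseteq> W"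
    using compact_in_open_separated[OF _ Ap(1) W] Ap(3) by blast
  have "(\<lambda>n. hausdorff_dist (B n) A) \<longlonglongrightarrow> 0"
    using X(2) x s unfolding smooth_at_def A_def B_def by blast
  then have "\<forall>\<^sub>F n in sequentially. hausdorff_dist (B n) A < e"
    by (rule order_tendstoD(2)) (fact e(1))
  then have ev: "\<forall>\<^sub>F n in sequentially. G p - G (s n) = log_change (B n) f (s n) p"
  proof eventually_elim
    case (elim n)
    have "B n \<subseteq> W"
    proof
      fix y assume "y \<in> B n"
      then have "infdist y A \<le> hausdorff_dist (B n) A"
        using compact_imp_bounded[OF Bp(1)] Ap(3) by (intro infdist_le_hausdorff_dist) auto
      then show "y \<in> W"
        using elim e(2) by auto
    qed
    then show ?case
      using Bp(2-4) continuous_on_subset[OF G(1)] G(2) by (intro log_change_eq[symmetric]) auto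
  qed
  have "isCont G x"
    using G(1) W Ap(3) by (auto simp: continuous_on_eq_continuous_at)
  then have "(\<lambda>n. G p - G (s n)) \<longlonglongrightarrow> G p - G x"
    using isCont_tendsto_compose[OF _ s(2)] by (intro tendsto_intros) auto
  moreover have "log_change A f x p = G p - G x"
    using Ap(2-4) W(2) continuous_on_subset[OF G(1)] G(2) by (intro log_change_eq) auto
  ultimately show ?thesis
    using tendsto_cong[OF ev] by (simp add: A_def B_def)
qed

text \<open>As long as \<phi> moves \<open>c\<close> by less than the distance from its image to
  that of \<open>A\<close>, \<open>log_change_perturb\<close> applies. The error consists of two
  values of \<open>Ln\<close> at quotients tending to 1. Injectivity makes that distance
  positive.\<close>

lemma log_change_translate_continuous_on:
  fixes A :: "'a::euclidean_space set" and \<phi> :: "'a \<Rightarrow> complex"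
  assumes A: "arc_between A x y" and \<phi>: "continuous_on UNIV \<phi>" "inj \<phi>"
  shows "continuous_on (- A) (\<lambda>c. log_change A (\<lambda>z. \<phi> z - \<phi> c) x y)"
proof (rule continuous_at_imp_continuous_on, rule ballI)
  fix c assume c: "c \<in> - A"
  note Ap = arc_between_imp[OF A]
  have cont\<phi>: "continuous_on S \<phi>" for S
    using \<phi>(1) by (rule continuous_on_subset) auto
  have nz: "\<phi> z - \<phi> c \<noteq> 0" if "z \<in> A" for z
    using c that \<phi>(2) by (auto simp: inj_eq)
  have "closed (\<phi> ` A)"
    using compact_continuous_image[OF cont\<phi> Ap(1)] by (rule compact_imp_closed)
  moreover have "\<phi> ` A \<noteq> {}" "\<phi> c \<notin> \<phi> ` A"
    using Ap(3) c \<phi>(2) by (auto simp: inj_eq)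
  ultimately have r: "infdist (\<phi> c) (\<phi> ` A) > 0"
    using infdist_pos_not_in_closed by blast
  have lim: "\<phi> \<midarrow>c\<rightarrow> \<phi> c"
    using \<phi>(1) by (auto simp: continuous_on_eq_continuous_at continuous_at)
  have "\<forall>\<^sub>F c' in at c. dist (\<phi> c') (\<phi> c) < infdist (\<phi> c) (\<phi> ` A)"
    using tendstoD[OF lim r] .
  then have ev: "\<forall>\<^sub>F c' in at c. log_change A (\<lambda>z. \<phi> z - \<phi> c) x y
      + (Ln ((\<phi> y - \<phi> c') / (\<phi> y - \<phi> c)) - Ln ((\<phi> x - \<phi> c') / (\<phi> x - \<phi> c)))
      = log_change A (\<lambda>z. \<phi> z - \<phi> c') x y"
  proof eventually_elim
    case (elim c')
    have "norm ((\<phi> z - \<phi> c') - (\<phi> z - \<phi> c)) < norm (\<phi> z - \<phi> c)" if "z \<in> A" for z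
      using elim infdist_le[of "\<phi> z" "\<phi> ` A" "\<phi> c"] that
      by (simp add: dist_norm norm_minus_commute)
    then show ?case
      using nz by (intro log_change_perturb[OF A, symmetric] continuous_intros cont\<phi>) auto
  qed
  have Ln: "((\<lambda>c'. Ln ((\<phi> z - \<phi> c') / (\<phi> z - \<phi> c))) \<longlongrightarrow> 0) (at c)" if "z \<in> A" for z
  proof -
    have "((\<lambda>c'. (\<phi> z - \<phi> c') / (\<phi> z - \<phi> c)) \<longlongrightarrow> 1) (at c)"
      using nz[OF that] by (auto intro!: tendsto_eq_intros lim)
    then have "((\<lambda>c'. Ln ((\<phi> z - \<phi> c') / (\<phi> z - \<phi> c))) \<longlongrightarrow> Ln 1) (at c)"
      by (rule tendsto_Ln) auto
    then show ?thesis by simp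
  qed
  have "((\<lambda>c'. log_change A (\<lambda>z. \<phi> z - \<phi> c) x y
      + (Ln ((\<phi> y - \<phi> c') / (\<phi> y - \<phi> c)) - Ln ((\<phi> x - \<phi> c') / (\<phi> x - \<phi> c))))
      \<longlongrightarrow> log_change A (\<lambda>z. \<phi> z - \<phi> c) x y + (0 - 0)) (at c)"
    using Ap by (intro tendsto_intros Ln) auto
  then show "isCont (\<lambda>c. log_change A (\<lambda>z. \<phi> z - \<phi> c) x y) c"
    using tendsto_cong[OF ev] by (simp add: continuous_at)
qed

section \<open>Separation by a cyclic order\<close>

text \<open>All values of \<open>F\<close> lie in one fibre of \<open>exp\<close>, whose points are
  at distance at least 1 from each other, so \<open>F\<close> is locally constant.\<close>

lemma openin_eq_set_of_discrete:
  fixes F :: "'a::metric_space \<Rightarrow> complex"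
  assumes "continuous_on S F" "\<And>x y. x \<in> S \<Longrightarrow> y \<in> S \<Longrightarrow> exp (F x) = exp (F y)"
  shows "openin (top_of_set S) {x\<in>S. P (F x)}"
  unfolding openin_contains_ball
proof (intro conjI ballI)
  fix x assume "x \<in> {x\<in>S. P (F x)}"
  then have x: "x \<in> S" "P (F x)" by auto
  obtain d where d: "d > 0" "\<And>y. y \<in> S \<Longrightarrow> dist y x < d \<Longrightarrow> dist (F y) (F x) < 1"
    using assms(1) x(1) unfolding continuous_on_iff by (metis zero_less_one)
  have "P (F y)" if "y \<in> S" "dist x y < d" for y
    using exp_eq_dist_less_imp_eq[OF assms(2)[OF that(1) x(1)]] d(2)[of y] that x(2)
    by (simp add: dist_commute)
  then show "\<exists>e>0. ball x e \<inter> S \<subseteq> {x\<in>S. P (F x)}"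
    using d(1) by (intro exI[of _ d]) auto
qed auto

text \<open>The condition on \<open>exp\<close> confines the cyclic sums to one fibre of
  \<open>exp\<close>, so their level sets are open, and it excludes the value 0. The points
  \<open>c\<^sub>0\<close> and \<open>d\<^sub>0\<close> become the separating pair when no other
  pair distinguishes \<open>a\<close> from \<open>b\<close>.\<close>

lemma separated_by_points_of_cocycle:
  fixes \<omega> :: "'a::metric_space \<Rightarrow> 'a \<Rightarrow> complex"
  assumes antisym: "\<And>x y. \<omega> y x = - \<omega> x y"
    and cont: "\<And>x. x \<in> Y \<Longrightarrow> continuous_on (Y - {x}) (\<omega> x)"
    and exp: "\<And>x y z. \<lbrakk>x \<in> Y; y \<in> Y; z \<in> Y; x \<noteq> y; y \<noteq> z; z \<noteq> x\<rbrakk>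
      \<Longrightarrow> exp (\<omega> x y + \<omega> y z + \<omega> z x) = -1"
    and ab: "a \<in> Y" "b \<in> Y" "a \<noteq> b"
    and cd: "c\<^sub>0 \<in> Y - {a, b}" "d\<^sub>0 \<in> Y - {a, b}" "c\<^sub>0 \<noteq> d\<^sub>0"
  shows "\<exists>c d. c \<in> Y - {a, b} \<and> d \<in> Y - {a, b} \<and> c \<noteq> d \<and> separated_by_points Y a b c d"
proof -
  define C where "C x y z = \<omega> x y + \<omega> y z + \<omega> z x" for x y z
  have op: "openin (top_of_set (Y - {x, y})) {z \<in> Y - {x, y}. P (C x y z)}"
    if "x \<in> Y" "y \<in> Y" "x \<noteq> y" for x y P
  proof (rule openin_eq_set_of_discrete)
    \<comment> \<open>Continuity is assumed in the second argument of \<omega> only, so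
      \<open>z\<close> is moved there by antisymmetry.\<close>
    have "C x y = (\<lambda>z. \<omega> x y + \<omega> y z - \<omega> x z)"
      using antisym[of x] by (simp add: C_def fun_eq_iff)
    then show "continuous_on (Y - {x, y}) (C x y)"
      using that by (auto intro!: continuous_intros continuous_on_subset[OF cont])
    fix z w assume "z \<in> Y - {x, y}" "w \<in> Y - {x, y}"
    then have "exp (C x y z) = -1" "exp (C x y w) = -1"
      using exp that unfolding C_def by auto
    then show "exp (C x y z) = exp (C x y w)" by simp
  qed
  show ?thesis
  proof (cases "\<exists>c d. c \<in> Y - {a, b} \<and> d \<in> Y - {a, b} \<and> c \<noteq> d \<and> C c d a \<noteq> C c d b")
    case True
    then obtain c d where cd: "c \<in> Y - {a, b}" "d \<in> Y - {a, b}" "c \<noteq> d" "C c d a \<noteq> C c d b"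
      by blast
    have "separated_by_points Y a b c d"
      unfolding separated_by_points_def
    proof (intro exI conjI)
      show "openin (top_of_set (Y - {c, d})) {z \<in> Y - {c, d}. C c d z = C c d a}"
        "openin (top_of_set (Y - {c, d})) {z \<in> Y - {c, d}. C c d z \<noteq> C c d a}"
        using op[of c d "\<lambda>v. v = C c d a"] op[of c d "\<lambda>v. v \<noteq> C c d a"] cd by auto
    qed (use cd ab in auto)
    then show ?thesis
      using cd(1-3) by blast
  next
    case False
    define c where "c = c\<^sub>0"
    have c: "c \<in> Y" "c \<noteq> a" "c \<noteq> b"
      using cd(1) by (auto simp: c_def)
    have nonzero: "C b c a \<noteq> 0"
      using exp[of b c a] ab c by (auto simp: C_def)
    define P where "P = {z \<in> Y - {b, c}. C b c z = C b c a}"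
    define Q where "Q = {z \<in> Y - {b, c}. C b c z \<noteq> C b c a}"
    \<comment> \<open>\<open>Q\<close> is open away from \<open>b\<close> and says nothing at
      \<open>b\<close> itself. \<open>N\<close> is a neighbourhood of \<open>b\<close>, and it will
      turn out to lie in \<open>insert b Q\<close>.\<close>
    define N where "N = {z \<in> Y - {a, c}. C a c z = C a c b}"
    have oPQ: "openin (top_of_set (Y - {b, c})) P" "openin (top_of_set (Y - {b, c})) Q"
      using op[of b c "\<lambda>v. v = C b c a"] op[of b c "\<lambda>v. v \<noteq> C b c a"] ab c
      by (auto simp: P_def Q_def)
    have oN: "openin (top_of_set (Y - {a, c})) N"
      using op[of a c "\<lambda>v. v = C a c b"] ab c by (auto simp: N_def)
    have NQ: "N \<subseteq> insert b Q"
    proof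
      fix z assume "z \<in> N"
      then have z: "z \<in> Y" "z \<noteq> a" "z \<noteq> c" and eq: "C a c z = C a c b"
        by (auto simp: N_def)
      show "z \<in> insert b Q"
      proof (cases "z = b")
        case False
        with \<open>\<not> (\<exists>c d. _ c d)\<close> z c have "C c z a = C c z b"
          by blast
        \<comment> \<open>The alternating sum of \<open>C\<close> over the four triples from
          \<open>a, b, c, z\<close> vanishes. Two of its terms agree because \<open>c, z\<close> do
          not distinguish \<open>a\<close> from \<open>b\<close>, so the other two agree as
          well.\<close>
        then have "C a b c = C a b z"
          using antisym[of c a] antisym[of c b] antisym[of z a] antisym[of z b] antisym[of z c]
          by (simp add: C_def algebra_simps)
        then have "C b c z = - C b c a"
          using eq antisym[of c a] antisym[of c b] antisym[of z a] antisym[of z b] antisym[of z c]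
            antisym[of b a]
          by (simp add: C_def algebra_simps)
        then have "C b c z \<noteq> C b c a"
          using nonzero by (auto simp: complex_eq_iff)
        then show ?thesis
          using False z by (simp add: Q_def)
      qed simp
    qed
    \<comment> \<open>The level sets are open in spaces lacking \<open>b\<close> or
      \<open>a\<close>, whereas the deleted pair must avoid both. Since singletons are closed,
      \<open>u\<close> can be put back into the space and \<open>d\<^sub>0\<close> taken
      out.\<close>
    have rel: "openin (top_of_set (Y - {c, d\<^sub>0})) (S - {d\<^sub>0})"
      if S: "openin (top_of_set (Y - {u, c})) S" for S u
    proof -
      obtain T where "open T" "S = (Y - {u, c}) \<inter> T"
        using S by (auto simp: openin_open)
      then show ?thesis
        by (auto simp: openin_open intro!: exI[of _ "T - {u, d\<^sub>0}"])
    qed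
    have "separated_by_points Y a b c d\<^sub>0"
      unfolding separated_by_points_def
    proof (intro exI conjI)
      show "openin (top_of_set (Y - {c, d\<^sub>0})) (P - {d\<^sub>0})"
        using rel[OF oPQ(1)] .
      have "insert b Q - {d\<^sub>0} = (Q - {d\<^sub>0}) \<union> (N - {d\<^sub>0})"
        using NQ ab c cd by (auto simp: N_def)
      then show "openin (top_of_set (Y - {c, d\<^sub>0})) (insert b Q - {d\<^sub>0})"
        using openin_Un[OF rel[OF oPQ(2)] rel[OF oN]] by simp
    qed (use cd ab c in \<open>auto simp: P_def Q_def\<close>)
    then show ?thesis
      using cd c_def by blast
  qed
qed

section \<open>The cocycle of a smooth plane dendroid\<close>

definition plane_to_complex :: "real ^ 2 \<Rightarrow> complex"
  where "plane_to_complex v = Complex (v $ 1) (v $ 2)"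

lemma continuous_on_plane_to_complex: "continuous_on S plane_to_complex"
  unfolding plane_to_complex_def Complex_eq by (intro continuous_intros)

lemma inj_plane_to_complex: "inj plane_to_complex"
  by (auto simp: inj_def plane_to_complex_def vec_eq_iff forall_2)

text \<open>The assumption \<open>two_other_points\<close> is implied by the conclusion, which asks
  for two distinct endpoints other than \<open>a\<close>, \<open>b\<close> and
  \<open>p\<close>.\<close>

theorem corollary10:
  fixes X :: "(real ^ 2) set" and p a b :: "real ^ 2"
  assumes "dendroid X"
    and "smooth_at X p"
    and "a \<in> endpoints X - {p}" and "b \<in> endpoints X - {p}" and "a \<noteq> b"
    and two_other_points:
      "\<exists>c d. c \<in> (endpoints X - {p}) - {a, b} \<and> d \<in> (endpoints X - {p}) - {a, b} \<and> c \<noteq> d"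
  shows "\<exists>c d. c \<in> (endpoints X - {p}) - {a, b} \<and> d \<in> (endpoints X - {p}) - {a, b} \<and> c \<noteq> d \<and>
           separated_by_points (endpoints X - {p}) a b c d"
proof -
  let ?\<phi> = plane_to_complex
  define Y where "Y = endpoints X - {p}"
  have p: "p \<in> X"
    using assms(2) by (simp add: smooth_at_def)
  have Y: "y \<in> X" "y \<noteq> p" "y \<in> endpoints X" if "y \<in> Y" for y
    using that by (auto simp: Y_def endpoints_def)
  define A where "A y = the_arc X y p" for y
  define \<Lambda> where "\<Lambda> c y = log_change (A y) (\<lambda>z. ?\<phi> z - ?\<phi> c) y p" for c y
  define \<omega> where "\<omega> x y = \<Lambda> x y - \<Lambda> y x" for x y
  have arc: "arc_between (A y) y p" if "y \<in> Y" for y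
    using the_arc_properties[OF assms(1) _ p] Y[OF that] by (auto simp: A_def)
  have notin: "c \<notin> A y" if "c \<in> Y" "y \<in> Y" "c \<noteq> y" for c y
    using endpoint_notin_the_arc[OF assms(1) p] Y that by (auto simp: A_def)
  have nz: "?\<phi> z - ?\<phi> c \<noteq> 0" if "c \<in> Y" "y \<in> Y" "c \<noteq> y" "z \<in> A y" for c y z
    using notin that inj_plane_to_complex by (auto simp: inj_eq)
  have exp_\<Lambda>: "exp (\<Lambda> c y) = (?\<phi> p - ?\<phi> c) / (?\<phi> y - ?\<phi> c)" if "c \<in> Y" "y \<in> Y" "c \<noteq> y" for c y
    unfolding \<Lambda>_def using nz[OF that]
    by (intro exp_log_change arc that continuous_intros continuous_on_plane_to_complex) auto
  \<comment> \<open>In \<open>exp (\<omega> u v)\<close> the differences of the images of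
    \<open>u\<close> and \<open>v\<close> cancel up to one sign. Around a triple the remaining
    ratios telescope, and the three signs leave -1.\<close>
  have ratio: "r / - d / (q / d) = - (r / q)" if "d \<noteq> 0" for r q d :: complex
    using that by simp
  have cyclic: "- (u / v) * - (v / w) * - (w / u) = -1" if "u \<noteq> 0" "v \<noteq> 0" "w \<noteq> 0"
    for u v w :: complex
    using that by simp
  have "\<exists>c d. c \<in> Y - {a, b} \<and> d \<in> Y - {a, b} \<and> c \<noteq> d \<and> separated_by_points Y a b c d"
  proof -
    obtain c\<^sub>0 d\<^sub>0 where cd: "c\<^sub>0 \<in> Y - {a, b}" "d\<^sub>0 \<in> Y - {a, b}" "c\<^sub>0 \<noteq> d\<^sub>0"
      using two_other_points by (auto simp: Y_def)
    show ?thesis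
    proof (rule separated_by_points_of_cocycle[where \<omega> = \<omega>, OF _ _ _ _ _ assms(5) cd])
      show "\<omega> y x = - \<omega> x y" for x y
        by (simp add: \<omega>_def)
      show "continuous_on (Y - {x}) (\<omega> x)" if x: "x \<in> Y" for x
      proof -
        \<comment> \<open>Here the arc varies and smoothness at \<open>p\<close> is used; in the
          other summand the arc of \<open>x\<close> is fixed and only the centre of the logarithm
          moves, off that arc.\<close>
        have "continuous_on (Y - {x}) (\<Lambda> x)"
          unfolding continuous_on_sequentially \<Lambda>_def A_def o_def
        proof (intro allI ballI impI, elim conjE)
          fix s y assume y: "y \<in> Y - {x}" and s: "\<forall>n. s n \<in> Y - {x}" "s \<longlonglongrightarrow> y"
          show "(\<lambda>n. log_change (the_arc X (s n) p) (\<lambda>z. ?\<phi> z - ?\<phi> x) (s n) p)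
              \<longlonglongrightarrow> log_change (the_arc X y p) (\<lambda>z. ?\<phi> z - ?\<phi> x) y p"
            using nz[OF x] y s Y
            by (intro log_change_the_arc_tendsto assms(1,2) continuous_intros
                continuous_on_plane_to_complex) (auto simp: A_def)
        qed
        moreover have "continuous_on (Y - {x}) (\<lambda>y. \<Lambda> y x)"
          unfolding \<Lambda>_def using notin x
          by (intro continuous_on_subset[OF log_change_translate_continuous_on[OF arc[OF x]]]
              continuous_on_plane_to_complex inj_plane_to_complex) auto
        ultimately show ?thesis
          unfolding \<omega>_def by (intro continuous_intros)
      qed
      show "exp (\<omega> x y + \<omega> y z + \<omega> z x) = -1"
        if "x \<in> Y" "y \<in> Y" "z \<in> Y" "x \<noteq> y" "y \<noteq> z" "z \<noteq> x" for x y z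
      proof -
        have exp_\<omega>: "exp (\<omega> u v) = - ((?\<phi> p - ?\<phi> u) / (?\<phi> p - ?\<phi> v))"
          if "u \<in> Y" "v \<in> Y" "u \<noteq> v" for u v
        proof -
          have D: "?\<phi> u - ?\<phi> v \<noteq> 0"
            using that(3) inj_plane_to_complex by (simp add: inj_eq)
          have "exp (\<omega> u v) = exp (\<Lambda> u v) / exp (\<Lambda> v u)"
            unfolding \<omega>_def by (rule exp_diff)
          also have "\<dots> = ((?\<phi> p - ?\<phi> u) / (?\<phi> v - ?\<phi> u)) / ((?\<phi> p - ?\<phi> v) / (?\<phi> u - ?\<phi> v))"
            unfolding exp_\<Lambda>[OF that] exp_\<Lambda>[OF that(2,1) that(3)[symmetric]] ..
          also have "\<dots> = - ((?\<phi> p - ?\<phi> u) / (?\<phi> p - ?\<phi> v))"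
            using ratio[OF D] by (simp only: minus_diff_eq)
          finally show ?thesis .
        qed
        have nonzero: "?\<phi> p - ?\<phi> u \<noteq> 0" if "u \<in> Y" for u
          using Y(2)[OF that] inj_plane_to_complex by (simp add: inj_eq)
        show ?thesis
          unfolding exp_add exp_\<omega>[OF that(1,2,4)] exp_\<omega>[OF that(2,3,5)] exp_\<omega>[OF that(3,1,6)]
          by (rule cyclic) (intro nonzero that)+
      qed
      show "a \<in> Y" "b \<in> Y"
        using assms(3,4) unfolding Y_def .
    qed
  qed
  then show ?thesis
    unfolding Y_def .
qed

end
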